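(* Let $0<\alpha<1$, $x>0$ and $y\in C^\infty[0,x]$. For integers $n\ge 4$ put $h=x/n$, $y_j=y(jh)$ for $0\le j\le n$, and define $$\sigma_0^{(\alpha)}=1-2\zeta(\alpha),\qquad \sigma_1^{(\alpha)}=\frac{1}{2^\alpha}+2\zeta(\alpha),\qquad \sigma_k^{(\alpha)}=\frac{1}{(k+1)^\alpha}-\frac{1}{(k-1)^\alpha}\quad (2\le k\le n-2),$$ $$\sigma_{n-1}^{(\alpha)}=-\frac{1}{(n-2)^\alpha}-2S_n[\alpha]+\frac{2n^{1-\alpha}}{1-\alpha},\qquad \sigma_n^{(\alpha)}=-\frac{1}{(n-1)^\alpha}+2S_n[\alpha]-\frac{2n^{1-\alpha}}{1-\alpha}.$$ Then, as $n\to\infty$ with $x$ fixed, $$\frac{1}{2\Gamma(1-\alpha)h^\alpha}\sum_{k=0}^{n}\sigma_k^{(\alpha)}y_{n-k}=y^{(\alpha)}(x)+O\left(h^{2-\alpha}\right).$$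
   Context: $\zeta$ is the Riemann zeta function (analytically continued). $S_n[a]=\sum_{k=1}^{n-1}k^{-a}-\zeta(a)$. For $0<\alpha<1$ the Caputo derivative is $y^{(\alpha)}(x)=\frac{1}{\Gamma(1-\alpha)}\int_0^x\frac{y'(t)}{(x-t)^\alpha}\,dt$. The constant implied by $O(\cdot)$ may depend on $y,\alpha,x$ but not on $n$. *)

theory Defs
  imports "HOL-Complex_Analysis.Complex_Analysis" "HOL-Library.Landau_Symbols"
begin

text \<open>
  The Riemann zeta function, as the analytic continuation of its Dirichlet series from
  \<open>Re w > 1\<close> to a half-plane containing \<open>s\<close>, punctured at \<open>1\<close>. Such a domain is connected and
  any two of them are nested, so the value does not depend on the choice of \<open>c\<close> and \<open>f\<close>.
  The value at \<open>s = 1\<close> is unspecified.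
\<close>
definition zeta :: "complex \<Rightarrow> complex" where
  "zeta s = (THE z. \<exists>c f. c < Re s \<and> f holomorphic_on ({w. c < Re w} - {1}) \<and>
     (\<forall>w. 1 < Re w \<longrightarrow> f w = (\<Sum>n. 1 / of_nat (Suc n) powr w)) \<and> z = f s)"

definition zeta_real :: "real \<Rightarrow> real" where
  "zeta_real a = Re (zeta (of_real a))"

definition S :: "nat \<Rightarrow> real \<Rightarrow> real" where
  "S n a = (\<Sum>k\<in>{1..<n}. real k powr (- a)) - zeta_real a"

text \<open>The derivative relative to \<open>A\<close>; it is one-sided at the endpoints of an interval.\<close>
definition deriv_on :: "real set \<Rightarrow> (real \<Rightarrow> real) \<Rightarrow> real \<Rightarrow> real" where
  "deriv_on A f = (\<lambda>t. vector_derivative f (at t within A))"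

definition C_infinity_on :: "real set \<Rightarrow> (real \<Rightarrow> real) \<Rightarrow> bool" where
  "C_infinity_on A f \<longleftrightarrow> (\<forall>k. (deriv_on A ^^ k) f differentiable_on A)"

text \<open>The integrand is \<open>0\<close> at \<open>t = x\<close>, because \<open>0 powr \<alpha> = 0\<close> and division by \<open>0\<close> gives \<open>0\<close>.\<close>
definition caputo :: "real \<Rightarrow> (real \<Rightarrow> real) \<Rightarrow> real \<Rightarrow> real" where
  "caputo \<alpha> y x = 1 / Gamma (1 - \<alpha>) *
     integral {0..x} (\<lambda>t. deriv_on {0..x} y t / (x - t) powr \<alpha>)"

text \<open>The weights are meant for \<open>n \<ge> 4\<close> and \<open>k \<le> n\<close>; the last branch is the case \<open>k = n\<close>.\<close>
definition \<sigma> :: "real \<Rightarrow> nat \<Rightarrow> nat \<Rightarrow> real" where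
  "\<sigma> \<alpha> n k =
     (if k = 0 then 1 - 2 * zeta_real \<alpha>
      else if k = 1 then 1 / 2 powr \<alpha> + 2 * zeta_real \<alpha>
      else if k \<le> n - 2 then 1 / (real k + 1) powr \<alpha> - 1 / (real k - 1) powr \<alpha>
      else if k = n - 1 then
        - 1 / (real n - 2) powr \<alpha> - 2 * S n \<alpha> + 2 * real n powr (1 - \<alpha>) / (1 - \<alpha>)
      else - 1 / (real n - 1) powr \<alpha> + 2 * S n \<alpha> - 2 * real n powr (1 - \<alpha>) / (1 - \<alpha>))"

end

theory Submission
  imports Defs "HOL-Real_Asymp.Real_Asymp"
begin

text \<open>
  Number the nodes backwards from \<open>x\<close>, writing \<open>z\<^sub>k = y (x - k h)\<close> and \<open>d\<^sub>k = z\<^sub>k - z\<^sub>k\<^sub>+\<^sub>1\<close>. The weights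
  come from replacing the derivative in the Caputo integral by central differences. Summed over the
  cells instead of the nodes, they give
  \<open>(\<Sum>k=1..n-1. (k powr -\<alpha> + (k+1) powr -\<alpha>) d\<^sub>k) + (1 - 2 \<zeta>(\<alpha>)) d\<^sub>0 - B\<^sub>n d\<^sub>n\<^sub>-\<^sub>1\<close>, where
  \<open>B\<^sub>n = n powr -\<alpha> + 2 (S\<^sub>n[\<alpha>] - n powr (1-\<alpha>) / (1-\<alpha>))\<close> (lemma \<open>sigma_sum_eq\<close>). Up to the factor
  \<open>h powr -\<alpha> / 2\<close>, the sum over \<open>k\<close> is the trapezoidal rule for the Stieltjes integral of
  \<open>(x - t) powr -\<alpha>\<close> against \<open>dy(t)\<close> on \<open>[0, x - h]\<close>, and the two other terms correct it at the ends.

  The scheme is exact when \<open>y\<close> is linear (lemma \<open>sigma_sum_linear\<close>), because the \<open>\<zeta>(\<alpha>)\<close> in the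
  coefficient of \<open>d\<^sub>0\<close> cancels the one in \<open>S\<^sub>n[\<alpha>]\<close>. So \<open>y\<close> may be replaced by \<open>u(t) = y(t) - y'(x) t\<close>, whose derivative
  vanishes at the singular point \<open>x\<close>. For such \<open>u\<close>, all errors have order \<open>h powr (2-\<alpha>)\<close>:

  \<^item> At distance \<open>s = k h\<close> from \<open>x\<close> one has \<open>u' = O(s)\<close>, so a cell of the trapezoidal rule contributes
    \<open>O(h\<^sup>3 s powr (-\<alpha>-1)) = O(h powr (2-\<alpha>) k powr (-\<alpha>-1))\<close>, and the sum over \<open>k\<close> converges; the
    omitted cell next to \<open>x\<close> has integral \<open>O(h powr (2-\<alpha>))\<close> (lemmas \<open>trapezoid_stieltjes\<close> and
    \<open>trapezoid_singular\<close>).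
  \<^item> \<open>d\<^sub>0 = O(h\<^sup>2)\<close>, because \<open>u' = O(h)\<close> on the last cell.
  \<^item> \<open>d\<^sub>n\<^sub>-\<^sub>1 = O(h)\<close> and \<open>B\<^sub>n = O(1/n)\<close> (lemma \<open>endpoint_weight_le\<close>). The latter compares
    \<open>\<Sum>k<n. k powr -\<alpha>\<close> with an integral, and \<open>\<zeta>(\<alpha>)\<close> is exactly the constant for which \<open>B\<^sub>n\<close> tends to
    \<open>0\<close> (lemma \<open>zeta_real_limit\<close>). It rests on the explicit continuation
    \<open>\<zeta>(w) = 1/(w-1) + (\<Sum>k\<ge>1. k powr -w - integral of t powr -w over [k, k+1])\<close> to \<open>Re w > 0\<close>.
\<close>

section \<open>The zeta function to the right of the imaginary axis\<close>

text \<open>Since \<open>t powr (1-w) / (1-w)\<close> is an antiderivative of \<open>t powr -w\<close>, the left-hand side is the integral of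
  \<open>k powr -w - t powr -w\<close> over \<open>[k, k+1]\<close>. Two applications of the mean value inequality bound it
  by the maximum of the derivative of \<open>t powr -w\<close>, which gains the power of \<open>k\<close> that makes the sum
  over \<open>k\<close> converge for \<open>Re w > 0\<close>.\<close>
lemma powr_cell_bound:
  fixes w :: complex and k :: real
  assumes "0 < Re w" "w \<noteq> 1" "0 < k"
  shows "norm (of_real k powr (-w) - (of_real (k+1) powr (1-w) - of_real k powr (1-w)) / (1-w))
           \<le> norm w * k powr (- Re w - 1)"
proof -
  define T where "T = closed_segment (complex_of_real k) (of_real (k+1))"
  have T: "\<exists>r. z = of_real r \<and> k \<le> r \<and> r \<le> k + 1" if "z \<in> T" for z
    using that unfolding T_def closed_segment_of_real by (auto simp: closed_segment_eq_real_ivl)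
  have cT: "convex T" by (simp add: T_def)
  have kT: "of_real k \<in> T" "of_real (k+1) \<in> T" by (auto simp: T_def)
  have nonneg: "z \<notin> \<real>\<^sub>\<le>\<^sub>0" if "z \<in> T" for z
    using T[OF that] assms by (auto)
  have dist: "norm (z - of_real k) \<le> 1" if z: "z \<in> T" for z
  proof -
    obtain r where "z = of_real r" "k \<le> r" "r \<le> k+1" using T[OF z] by auto
    hence "z - of_real k = of_real (r - k)" "\<bar>r - k\<bar> \<le> 1" by auto
    thus ?thesis by (metis norm_of_real)
  qed
  have 1: "norm (z powr (-w) - of_real k powr (-w)) \<le> norm w * k powr (- Re w - 1)" if "z \<in> T" for z
  proof -
    have "norm (z powr (-w) - of_real k powr (-w)) \<le> norm w * k powr (- Re w - 1) * norm (z - of_real k)"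
    proof (rule field_differentiable_bound[OF cT _ _ that kT(1), where f' = "\<lambda>z. (-w) * z powr (-w-1)"])
      fix u assume u: "u \<in> T"
      show "((\<lambda>u. u powr (-w)) has_field_derivative (-w) * u powr (-w-1)) (at u within T)"
        using has_field_derivative_powr[OF nonneg[OF u]] by (rule has_field_derivative_at_within)
      obtain r where r: "u = of_real r" "k \<le> r" using T[OF u] by auto
      have "r powr (- Re w - 1) \<le> k powr (- Re w - 1)"
        using assms r by (intro powr_mono2') auto
      thus "norm ((-w) * u powr (-w-1)) \<le> norm w * k powr (- Re w - 1)"
        using r assms by (simp add: norm_mult norm_powr_real_powr mult_left_mono)
    qed
    also have "\<dots> \<le> norm w * k powr (- Re w - 1) * 1"
      using dist[OF that] by (intro mult_left_mono) auto
    finally show ?thesis by simp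
  qed
  define G where "G = (\<lambda>z. of_real k powr (-w) * z - z powr (1-w) / (1-w))"
  have "norm (G (of_real (k+1)) - G (of_real k)) \<le> norm w * k powr (- Re w - 1) * norm (complex_of_real (k+1) - of_real k)"
  proof (rule field_differentiable_bound[OF cT _ _ kT(2) kT(1), where f' = "\<lambda>z. of_real k powr (-w) - z powr (-w)"])
    fix u assume u: "u \<in> T"
    have "((\<lambda>u. u powr (1-w)) has_field_derivative (1-w) * u powr (-w)) (at u within T)"
      using has_field_derivative_at_within[OF has_field_derivative_powr[OF nonneg[OF u], of "1-w"]] by simp
    hence "(G has_field_derivative of_real k powr (-w) * 1 - (1-w) * u powr (-w) / (1-w)) (at u within T)"
      unfolding G_def by (intro DERIV_diff DERIV_cmult DERIV_cdivide DERIV_ident)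
    thus "(G has_field_derivative of_real k powr (-w) - u powr (-w)) (at u within T)"
      using assms by simp
    show "norm (of_real k powr (-w) - u powr (-w)) \<le> norm w * k powr (- Re w - 1)"
      using 1[OF u] by (simp add: norm_minus_commute)
  qed
  thus ?thesis by (simp add: G_def algebra_simps diff_divide_distrib)
qed

text \<open>The cell \<open>[n+1, n+2]\<close>, so that the series over \<open>n\<close> starts with \<open>[1, 2]\<close>.\<close>
definition zeta_cell :: "nat \<Rightarrow> complex \<Rightarrow> complex" where
  "zeta_cell n w = of_nat (Suc n) powr (-w)
     - (of_nat (Suc (Suc n)) powr (1-w) - of_nat (Suc n) powr (1-w)) / (1-w)"

lemma norm_zeta_cell_le:
  assumes "0 < Re w" "w \<noteq> 1"
  shows "norm (zeta_cell n w) \<le> norm w * real (Suc n) powr (- Re w - 1)"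
  using powr_cell_bound[OF assms, of "real (Suc n)"] by (simp add: zeta_cell_def add_ac)

lemma summable_Suc_powr:
  fixes e :: real
  assumes "0 < e"
  shows "summable (\<lambda>n. real (Suc n) powr (- e - 1))"
  using assms summable_real_powr_iff[of "- e - 1"]
  by (subst summable_Suc_iff[of "\<lambda>n. real n powr (- e - 1)"]) simp

lemma summable_zeta_cell:
  assumes "0 < Re w" "w \<noteq> 1"
  shows "summable (\<lambda>n. zeta_cell n w)"
  by (rule summable_comparison_test'[OF summable_mult[OF summable_Suc_powr[OF assms(1)]]])
     (rule norm_zeta_cell_le[OF assms])

text \<open>On a disc around \<open>w0\<close> whose radius is at most half of \<open>Re w0\<close> and half of the distance to \<open>1\<close>,
  the bound on the single cells is uniform, so the Weierstrass test applies.\<close>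
lemma holomorphic_sum_zeta_cell:
  "(\<lambda>w. \<Sum>n. zeta_cell n w) holomorphic_on ({w. 0 < Re w} - {1})"
proof (rule holomorphic_uniform_sequence[where f = "\<lambda>N w. \<Sum>n<N. zeta_cell n w"])
  show "open ({w. 0 < Re w} - {1})" by (intro open_Diff open_halfspace_Re_gt) auto
  show "(\<lambda>w. \<Sum>n<N. zeta_cell n w) holomorphic_on ({w. 0 < Re w} - {1})" for N
    unfolding zeta_cell_def by (intro holomorphic_intros) auto
  fix w0 :: complex assume "w0 \<in> {w. 0 < Re w} - {1}"
  hence w0: "0 < Re w0" "w0 \<noteq> 1" by auto
  define d where "d = min (Re w0) (norm (w0 - 1)) / 2"
  have d: "0 < d" "d < Re w0" "d < norm (w0 - 1)" "d \<le> Re w0 / 2" using w0 zero_less_norm_iff[of "w0 - 1"] by (auto simp: d_def min_def simp del: zero_less_norm_iff)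
  have near: "Re w0 / 2 \<le> Re w" "w \<noteq> 1" "norm w \<le> norm w0 + d" if w: "w \<in> cball w0 d" for w
  proof -
    have n: "norm (w0 - w) \<le> d" using w by (simp add: dist_norm)
    have "Re (w0 - w) \<le> d" using n complex_Re_le_cmod order_trans by blast
    thus "Re w0 / 2 \<le> Re w" using d by simp
    show "w \<noteq> 1" using n d by auto
    show "norm w \<le> norm w0 + d" using n norm_triangle_ineq3[of w w0] by (simp add: norm_minus_commute)
  qed
  have "uniform_limit (cball w0 d) (\<lambda>N w. \<Sum>n<N. zeta_cell n w) (\<lambda>w. \<Sum>n. zeta_cell n w) sequentially"
  proof (rule Weierstrass_m_test)
    show "summable (\<lambda>n. (norm w0 + d) * real (Suc n) powr (- (Re w0 / 2) - 1))"
      using w0 by (intro summable_mult summable_Suc_powr) auto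
    fix n w assume w: "w \<in> cball w0 d"
    have "norm (zeta_cell n w) \<le> norm w * real (Suc n) powr (- Re w - 1)"
      using near[OF w] w0 by (intro norm_zeta_cell_le) auto
    also have "\<dots> \<le> (norm w0 + d) * real (Suc n) powr (- (Re w0 / 2) - 1)"
      using near[OF w] d by (intro mult_mono powr_mono) auto
    finally show "norm (zeta_cell n w) \<le> (norm w0 + d) * real (Suc n) powr (- (Re w0 / 2) - 1)" .
  qed
  moreover have "cball w0 d \<subseteq> {w. 0 < Re w} - {1}" using near w0 by force
  ultimately show "\<exists>d>0. cball w0 d \<subseteq> {w. 0 < Re w} - {1} \<and>
      uniform_limit (cball w0 d) (\<lambda>N w. \<Sum>n<N. zeta_cell n w) (\<lambda>w. \<Sum>n. zeta_cell n w) sequentially"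
    using d by blast
qed

text \<open>Where the Dirichlet series converges, the integrals in the cells telescope to
  the integral of \<open>t powr -w\<close> from \<open>1\<close> to infinity, which the first summand restores.\<close>
lemma dirichlet_series_eq:
  assumes "1 < Re w"
  shows "1 / (w - 1) + (\<Sum>n. zeta_cell n w) = (\<Sum>n. 1 / of_nat (Suc n) powr w)"
proof -
  have w: "w \<noteq> 1" "0 < Re w" using assms by auto
  define g where "g = (\<lambda>n. of_nat (Suc n) powr (1-w) / (1-w))"
  have "(\<lambda>n. real (Suc n) powr (- (Re w - 1))) \<longlonglongrightarrow> 0"
    using assms by real_asymp
  hence "(\<lambda>n. norm (g n)) \<longlonglongrightarrow> 0"
    unfolding g_def norm_divide using norm_powr_real_powr[of "of_nat (Suc _)" "1 - w"]
    by (intro tendsto_divide_zero) (simp add: norm_powr_real_powr)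
  hence "g \<longlonglongrightarrow> 0" by (rule tendsto_norm_zero_cancel)
  hence "(\<lambda>n. g (Suc n) - g n) sums (0 - g 0)" by (rule telescope_sums)
  from sums_add[OF summable_sums[OF summable_zeta_cell[OF w(2,1)]] this]
  have "(\<lambda>n. of_nat (Suc n) powr (-w)) sums ((\<Sum>n. zeta_cell n w) - 1 / (1 - w))"
    by (simp add: zeta_cell_def g_def diff_divide_distrib)
  hence "(\<Sum>n. 1 / of_nat (Suc n) powr w) = (\<Sum>n. zeta_cell n w) - 1 / (1 - w)"
    by (simp add: powr_minus_divide sums_iff)
  moreover have "1 / (w - 1) = - (1 / (1 - w))" by (simp add: minus_divide_right)
  ultimately show ?thesis by simp
qed

text \<open>Any two continuations agree by the identity theorem: a half-plane punctured at \<open>1\<close> is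
  connected.\<close>
lemma zeta_eq:
  assumes "0 < Re s" "s \<noteq> 1"
  shows "zeta s = 1 / (s - 1) + (\<Sum>n. zeta_cell n s)"
  unfolding zeta_def
proof (rule the_equality)
  define Z where "Z = (\<lambda>w. 1 / (w - 1) + (\<Sum>n. zeta_cell n w))"
  have hol: "Z holomorphic_on ({w. 0 < Re w} - {1})"
    unfolding Z_def by (intro holomorphic_intros holomorphic_sum_zeta_cell) auto
  show "\<exists>c f. c < Re s \<and> f holomorphic_on ({w. c < Re w} - {1}) \<and>
     (\<forall>w. 1 < Re w \<longrightarrow> f w = (\<Sum>n. 1 / of_nat (Suc n) powr w)) \<and>
     1 / (s - 1) + (\<Sum>n. zeta_cell n s) = f s"
    using hol assms by (intro exI[of _ 0] exI[of _ Z]) (simp add: Z_def dirichlet_series_eq)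
  fix z assume "\<exists>c f. c < Re s \<and> f holomorphic_on ({w. c < Re w} - {1}) \<and>
     (\<forall>w. 1 < Re w \<longrightarrow> f w = (\<Sum>n. 1 / of_nat (Suc n) powr w)) \<and> z = f s"
  then obtain c f where c: "c < Re s" and f: "f holomorphic_on ({w. c < Re w} - {1})"
    and eq: "\<And>w. 1 < Re w \<Longrightarrow> f w = (\<Sum>n. 1 / of_nat (Suc n) powr w)" and z: "z = f s" by blast
  define b where "b = max c 0"
  define m where "m = max b 1"
  have "f s = Z s"
  proof (rule analytic_continuation_open[of "{w. m < Re w}" "{w. b < Re w} - {1}" f Z])
    show "open {w. m < Re w}" "open ({w. b < Re w} - {1})"
      by (auto intro!: open_Diff open_halfspace_Re_gt)
    have "of_real (m + 1) \<in> {w. m < Re w}" by simp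
    thus "{w. m < Re w} \<noteq> {}" by blast
    show "connected ({w. b < Re w} - {1})"
      by (intro connected_open_delete open_halfspace_Re_gt convex_connected convex_halfspace_Re_gt) simp
    show "{w. m < Re w} \<subseteq> {w. b < Re w} - {1}" by (auto simp: m_def)
    show "f holomorphic_on ({w. b < Re w} - {1})" by (rule holomorphic_on_subset[OF f]) (auto simp: b_def)
    show "Z holomorphic_on ({w. b < Re w} - {1})" by (rule holomorphic_on_subset[OF hol]) (auto simp: b_def)
    show "f w = Z w" if "w \<in> {w. m < Re w}" for w
      using that by (simp add: eq Z_def dirichlet_series_eq m_def)
    show "s \<in> {w. b < Re w} - {1}" using assms c by (auto simp: b_def)
  qed
  thus "z = 1 / (s - 1) + (\<Sum>n. zeta_cell n s)" by (simp add: z Z_def)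
qed

text \<open>The partial sums of the continuation at \<open>w = \<alpha>\<close>. For \<open>\<alpha> < 1\<close> the telescoped integral grows
  like \<open>N powr (1-\<alpha>)\<close>, and subtracting it is what makes the divergent sum converge to \<open>\<zeta>(\<alpha>)\<close>.\<close>
lemma zeta_real_limit:
  fixes \<alpha> :: real
  assumes "0 < \<alpha>" "\<alpha> < 1"
  shows "(\<lambda>N. (\<Sum>k=1..<Suc N. real k powr (-\<alpha>)) - real (Suc N) powr (1-\<alpha>) / (1-\<alpha>))
           \<longlonglongrightarrow> zeta_real \<alpha>"
proof -
  define r where "r = (\<lambda>n. real (Suc n) powr (-\<alpha>)
    - (real (Suc (Suc n)) powr (1-\<alpha>) - real (Suc n) powr (1-\<alpha>)) / (1-\<alpha>))"
  have r: "zeta_cell n (of_real \<alpha>) = of_real (r n)" for n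
    using powr_of_real[of "real (Suc n)" "-\<alpha>"] powr_of_real[of "real (Suc n)" "1-\<alpha>"]
      powr_of_real[of "real (Suc (Suc n))" "1-\<alpha>"]
    by (simp add: zeta_cell_def r_def)
  have partial: "(\<Sum>n<N. r n) - 1 / (1-\<alpha>)
      = (\<Sum>k=1..<Suc N. real k powr (-\<alpha>)) - real (Suc N) powr (1-\<alpha>) / (1-\<alpha>)" for N
    by (induction N) (simp_all add: r_def diff_divide_distrib)
  have s: "summable (\<lambda>n. zeta_cell n (of_real \<alpha>))" using assms by (intro summable_zeta_cell) auto
  have "(\<lambda>n. Re (zeta_cell n (of_real \<alpha>))) sums Re (\<Sum>n. zeta_cell n (of_real \<alpha>))"
    by (rule sums_Re[OF summable_sums[OF s]])
  hence "(\<lambda>N. \<Sum>n<N. r n) \<longlonglongrightarrow> Re (\<Sum>n. zeta_cell n (of_real \<alpha>))"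
    by (simp add: r sums_def)
  moreover have "zeta_real \<alpha> = Re (\<Sum>n. zeta_cell n (of_real \<alpha>)) - 1 / (1-\<alpha>)"
  proof -
    have "1 / (complex_of_real \<alpha> - 1) = of_real (- (1 / (1-\<alpha>)))"
      by (simp add: divide_simps)
    moreover have "zeta (of_real \<alpha>) = 1 / (complex_of_real \<alpha> - 1) + (\<Sum>n. zeta_cell n (of_real \<alpha>))"
      using assms by (intro zeta_eq) auto
    ultimately show ?thesis by (simp only: zeta_real_def plus_complex.sel Re_complex_of_real)
  qed
  ultimately show ?thesis
    unfolding partial[symmetric] by (auto intro: tendsto_diff tendsto_const)
qed

section \<open>Trapezoidal rule for a Stieltjes integral\<close>

text \<open>With \<open>P\<close> an antiderivative of \<open>u' \<omega>\<close>, this bounds the error of the trapezoidal rule for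
  \<open>\<integral> \<omega> du\<close>. Using increments of \<open>u\<close>, rather than values of \<open>u'\<close>, lets it apply directly to difference
  schemes and needs only two derivatives of \<open>u\<close>.\<close>
lemma trapezoid_stieltjes:
  fixes P u u1 u2 \<omega> \<omega>1 \<omega>2 :: "real \<Rightarrow> real"
  assumes "a \<le> b"
    and P: "\<And>t. t \<in> {a..b} \<Longrightarrow> (P has_real_derivative u1 t * \<omega> t) (at t within {a..b})"
    and u: "\<And>t. t \<in> {a..b} \<Longrightarrow> (u has_real_derivative u1 t) (at t within {a..b})"
    and u1: "\<And>t. t \<in> {a..b} \<Longrightarrow> (u1 has_real_derivative u2 t) (at t within {a..b})"
    and w: "\<And>t. t \<in> {a..b} \<Longrightarrow> (\<omega> has_real_derivative \<omega>1 t) (at t within {a..b})"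
    and w1: "\<And>t. t \<in> {a..b} \<Longrightarrow> (\<omega>1 has_real_derivative \<omega>2 t) (at t within {a..b})"
    and bounds: "\<And>t. t \<in> {a..b} \<Longrightarrow> \<bar>u1 t\<bar> \<le> U1" "\<And>t. t \<in> {a..b} \<Longrightarrow> \<bar>u2 t\<bar> \<le> U2"
      "\<And>t. t \<in> {a..b} \<Longrightarrow> \<bar>\<omega>1 t\<bar> \<le> W1" "\<And>t. t \<in> {a..b} \<Longrightarrow> \<bar>\<omega>2 t\<bar> \<le> W2"
  shows "\<bar>P b - P a - (u b - u a) * (\<omega> a + \<omega> b) / 2\<bar> \<le> (U1 * W2 + U2 * W1) * (b - a) ^ 3"
proof -
  have taylor: "\<bar>f t - f a - (t - a) * f1 t\<bar> \<le> B * (b - a)\<^sup>2"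
    if f: "\<And>t. t \<in> {a..b} \<Longrightarrow> (f has_real_derivative f1 t) (at t within {a..b})"
      and f1: "\<And>t. t \<in> {a..b} \<Longrightarrow> (f1 has_real_derivative f2 t) (at t within {a..b})"
      and f2: "\<And>t. t \<in> {a..b} \<Longrightarrow> \<bar>f2 t\<bar> \<le> B" and t: "t \<in> {a..b}" for f f1 f2 t B
  proof -
    have B: "0 \<le> B" using f2[OF t] by linarith
    have "norm ((f t - t * f1 t) - (f a - a * f1 t)) \<le> (B * (b - a)) * norm (t - a)"
    proof (rule field_differentiable_bound[of "{a..b}" _ "\<lambda>s. f1 s - f1 t"])
      fix s assume s: "s \<in> {a..b}"
      show "((\<lambda>s. f s - s * f1 t) has_real_derivative f1 s - f1 t) (at s within {a..b})"
        by (auto intro!: derivative_eq_intros f[OF s])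
      have "norm (f1 s - f1 t) \<le> B * norm (s - t)"
        by (rule field_differentiable_bound[of "{a..b}" _ f2]) (use f1 f2 s t in auto)
      also have "\<dots> \<le> B * (b - a)" using B s t by (intro mult_left_mono) auto
      finally show "norm (f1 s - f1 t) \<le> B * (b - a)" .
    qed (use t \<open>a \<le> b\<close> in auto)
    also have "\<dots> \<le> (B * (b - a)) * (b - a)" using B t by (intro mult_left_mono) auto
    finally show ?thesis by (simp add: algebra_simps power2_eq_square)
  qed
  have aa: "a \<in> {a..b}" using \<open>a \<le> b\<close> by auto
  have U1: "0 \<le> U1" and W1: "0 \<le> W1" using bounds(1,3)[OF aa] by linarith+
  \<comment> \<open>The quadrature error on \<open>{a..t}\<close>; in its derivative the zeroth and first order terms cancel,
    leaving two Taylor remainders.\<close>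
  define F where "F = (\<lambda>t. P t - (u t - u a) * (\<omega> a + \<omega> t) / 2)"
  have "norm (F b - F a) \<le> (U1 * W2 + U2 * W1) * (b - a)\<^sup>2 * norm (b - a)"
  proof (rule field_differentiable_bound[of "{a..b}" _
        "\<lambda>t. (u1 t * (\<omega> t - \<omega> a - (t - a) * \<omega>1 t) - (u t - u a - (t - a) * u1 t) * \<omega>1 t) / 2"])
    fix t assume t: "t \<in> {a..b}"
    show "(F has_real_derivative
        (u1 t * (\<omega> t - \<omega> a - (t - a) * \<omega>1 t) - (u t - u a - (t - a) * u1 t) * \<omega>1 t) / 2)
        (at t within {a..b})"
      unfolding F_def
      by (rule derivative_eq_intros P[OF t] u[OF t] w[OF t] refl | simp)+ (simp add: field_simps)
    have "\<bar>u1 t * (\<omega> t - \<omega> a - (t - a) * \<omega>1 t)\<bar> \<le> U1 * (W2 * (b - a)\<^sup>2)"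
      unfolding abs_mult using U1 by (intro mult_mono bounds(1)[OF t] taylor[OF w w1 bounds(4) t]) auto
    moreover have "\<bar>(u t - u a - (t - a) * u1 t) * \<omega>1 t\<bar> \<le> (U2 * (b - a)\<^sup>2) * W1"
      unfolding abs_mult using order_trans[OF abs_ge_zero bounds(2)[OF t]]
      by (intro mult_mono bounds(3)[OF t] taylor[OF u u1 bounds(2) t]) auto
    moreover have "norm ((p - q) / 2) \<le> X + Y" if "\<bar>p\<bar> \<le> X" "\<bar>q\<bar> \<le> Y" for p q X Y :: real
    proof -
      have "p \<le> X" "- X \<le> p" "q \<le> Y" "- Y \<le> q" using that by auto
      thus ?thesis unfolding real_norm_def by (intro abs_leI) (simp_all add: field_simps)
    qed
    ultimately have "norm ((u1 t * (\<omega> t - \<omega> a - (t - a) * \<omega>1 t) - (u t - u a - (t - a) * u1 t) * \<omega>1 t) / 2)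
        \<le> U1 * (W2 * (b - a)\<^sup>2) + (U2 * (b - a)\<^sup>2) * W1"
      by blast
    thus "norm ((u1 t * (\<omega> t - \<omega> a - (t - a) * \<omega>1 t) - (u t - u a - (t - a) * u1 t) * \<omega>1 t) / 2)
        \<le> (U1 * W2 + U2 * W1) * (b - a)\<^sup>2"
      by (simp only: algebra_simps)
  qed (use \<open>a \<le> b\<close> in auto)
  thus ?thesis using \<open>a \<le> b\<close> by (simp add: F_def power3_eq_cube power2_eq_square mult.assoc)
qed

section \<open>The weight of the first cell\<close>

text \<open>Up to sign, the coefficient of \<open>y\<^sub>1 - y\<^sub>0\<close> that remains once the trapezoidal sum is split off;
  the first two terms of the Euler--Maclaurin expansion of \<open>S n \<alpha>\<close> cancel in it.\<close>
definition endpoint_weight :: "real \<Rightarrow> nat \<Rightarrow> real" where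
  "endpoint_weight \<alpha> n = real n powr (-\<alpha>) + 2 * (S n \<alpha> - real n powr (1-\<alpha>) / (1-\<alpha>))"

text \<open>The partial sums \<open>E n\<close> are corrected so that \<open>E (n+1) - E n\<close> is, up to sign, the trapezoidal error of
  \<open>t powr -\<alpha>\<close> on \<open>[n, n+1]\<close>. That error is \<open>O(1/n\<^sup>2)\<close>, while \<open>E n\<close> tends to \<open>\<zeta>(\<alpha>)\<close>, so the distance to the
  limit is \<open>O(1/n)\<close>.\<close>
lemma endpoint_weight_le:
  fixes \<alpha> :: real
  assumes "0 < \<alpha>" "\<alpha> < 1" "2 \<le> n"
  shows "\<bar>endpoint_weight \<alpha> n\<bar> \<le> 4 * \<alpha> * (\<alpha> + 1) / (real n - 1)"
proof -
  define E where "E = (\<lambda>n. (\<Sum>k=1..<n. real k powr (-\<alpha>)) - real n powr (1-\<alpha>) / (1-\<alpha>) + real n powr (-\<alpha>) / 2)"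
  define C where "C = \<alpha> * (\<alpha> + 1)"
  have C: "0 \<le> C" using assms by (simp add: C_def)
  have cell: "\<bar>E (Suc k) - E k\<bar> \<le> C * (1 / (real k - 1) - 1 / real k)" if "2 \<le> k" for k
  proof -
    have k: "1 < real k" using that by simp
    have "\<bar>(real k + 1) powr (1-\<alpha>) / (1-\<alpha>) - real k powr (1-\<alpha>) / (1-\<alpha>)
        - ((real k + 1) - real k) * (real k powr (-\<alpha>) + (real k + 1) powr (-\<alpha>)) / 2\<bar>
        \<le> (1 * (C * real k powr (-2)) + 0 * \<alpha>) * (real k + 1 - real k) ^ 3"
    proof (rule trapezoid_stieltjes[where ?u1.0 = "\<lambda>_. 1" and ?u2.0 = "\<lambda>_. 0" and u = "\<lambda>t. t"
          and ?\<omega>1.0 = "\<lambda>t. -\<alpha> * t powr (-\<alpha>-1)" and ?\<omega>2.0 = "\<lambda>t. \<alpha> * (\<alpha>+1) * t powr (-\<alpha>-2)"])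
      fix t assume t: "t \<in> {real k..real k + 1}"
      hence t0: "0 < t" "1 \<le> t" using k by auto
      have D: "((\<lambda>t. t powr r) has_real_derivative r * t powr (r - 1)) (at t within A)" for r A
        by (rule has_field_derivative_at_within[OF has_real_derivative_powr[OF t0(1)]])
      show "((\<lambda>t. t powr (1-\<alpha>) / (1-\<alpha>)) has_real_derivative 1 * t powr (-\<alpha>)) (at t within {real k..real k + 1})"
        using DERIV_cdivide[OF D[where r = "1-\<alpha>"], where c = "1-\<alpha>"] assms by simp
      show "((\<lambda>t. t powr (-\<alpha>)) has_real_derivative -\<alpha> * t powr (-\<alpha>-1)) (at t within {real k..real k + 1})"
        by (rule D)
      have "(-\<alpha>) * ((-\<alpha>-1) * t powr (-\<alpha>-1-1)) = \<alpha> * (\<alpha>+1) * t powr (-\<alpha>-2)"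
        by (simp add: algebra_simps)
      thus "((\<lambda>t. -\<alpha> * t powr (-\<alpha>-1)) has_real_derivative \<alpha> * (\<alpha>+1) * t powr (-\<alpha>-2)) (at t within {real k..real k + 1})"
        using DERIV_cmult[OF D[where r = "-\<alpha>-1"], where c = "-\<alpha>"] by simp
      have "t powr (-\<alpha>-2) \<le> t powr (-2)" using t0 assms by (intro powr_mono) auto
      also have "\<dots> \<le> real k powr (-2)" using t k by (intro powr_mono2') auto
      finally show "\<bar>\<alpha> * (\<alpha>+1) * t powr (-\<alpha>-2)\<bar> \<le> C * real k powr (-2)"
        using C assms by (simp add: C_def abs_mult mult_left_mono)
      have "t powr (-\<alpha>-1) \<le> t powr 0" using t0 assms by (intro powr_mono) auto
      thus "\<bar>-\<alpha> * t powr (-\<alpha>-1)\<bar> \<le> \<alpha>" using t0 assms by (simp add: abs_mult mult_left_le)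
    qed (use k in auto)
    also have "\<dots> = C * (1 / (real k)\<^sup>2)" using k by (simp add: powr_minus_divide powr_numeral)
    also have "\<dots> \<le> C * (1 / (real k - 1) - 1 / real k)"
      using C k by (intro mult_left_mono) (auto simp: divide_simps power2_eq_square)
    also have "(real k + 1) powr (1-\<alpha>) / (1-\<alpha>) - real k powr (1-\<alpha>) / (1-\<alpha>)
        - ((real k + 1) - real k) * (real k powr (-\<alpha>) + (real k + 1) powr (-\<alpha>)) / 2 = - (E (Suc k) - E k)"
      using that by (simp add: E_def add_ac algebra_simps add_divide_distrib)
    finally show ?thesis by simp
  qed
  have "\<bar>E (n + j) - E n\<bar> \<le> C * (1 / (real n - 1) - 1 / (real (n + j) - 1))" for j
  proof (induction j)
    case (Suc j)
    have "\<bar>E (n + Suc j) - E n\<bar> \<le> \<bar>E (n + j) - E n\<bar> + \<bar>E (Suc (n + j)) - E (n + j)\<bar>" by simp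
    also have "\<dots> \<le> C * (1 / (real n - 1) - 1 / (real (n + j) - 1)) + C * (1 / (real (n + j) - 1) - 1 / real (n + j))"
      using assms by (intro add_mono Suc.IH cell) auto
    finally show ?case by (simp add: algebra_simps)
  qed simp
  moreover have "C * (1 / (real n - 1) - 1 / (real (n + j) - 1)) \<le> C / (real n - 1)" for j
  proof -
    have "0 \<le> 1 / (real (n + j) - 1)" using assms by simp
    from mult_left_mono[OF this C] show ?thesis by (simp add: right_diff_distrib)
  qed
  ultimately have tail: "\<bar>E (n + j) - E n\<bar> \<le> C / (real n - 1)" for j using order_trans by blast
  have "(\<lambda>N. E (Suc N)) \<longlonglongrightarrow> zeta_real \<alpha> + 0"
    unfolding E_def
  proof (intro tendsto_add zeta_real_limit assms)
    show "(\<lambda>N. real (Suc N) powr (-\<alpha>) / 2) \<longlonglongrightarrow> 0" using assms by real_asymp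
  qed
  hence "E \<longlonglongrightarrow> zeta_real \<alpha>" by (simp add: filterlim_sequentially_Suc)
  hence "(\<lambda>j. E (j + n)) \<longlonglongrightarrow> zeta_real \<alpha>" by (rule LIMSEQ_ignore_initial_segment)
  hence "(\<lambda>j. \<bar>E (n + j) - E n\<bar>) \<longlonglongrightarrow> \<bar>zeta_real \<alpha> - E n\<bar>"
    by (intro tendsto_intros) (simp add: add.commute)
  hence "\<bar>zeta_real \<alpha> - E n\<bar> \<le> C / (real n - 1)"
    using tail by (intro LIMSEQ_le_const2[of _ _ "C / (real n - 1)"]) auto
  moreover have "endpoint_weight \<alpha> n = - 2 * (zeta_real \<alpha> - E n)"
    by (simp add: E_def S_def endpoint_weight_def)
  moreover have "0 \<le> C / (real n - 1)" using C assms by simp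
  ultimately show ?thesis by (simp add: C_def abs_mult)
qed

section \<open>Quadrature up to the singular point\<close>

lemma abs_le_of_zero_at_right_end:
  fixes f f' :: "real \<Rightarrow> real"
  assumes f: "\<And>t. t \<in> {a..b} \<Longrightarrow> (f has_real_derivative f' t) (at t within {a..b})"
    and M: "\<And>t. t \<in> {a..b} \<Longrightarrow> \<bar>f' t\<bar> \<le> M" and "f b = 0" and t: "t \<in> {a..b}"
  shows "\<bar>f t\<bar> \<le> M * (b - t)"
proof -
  have "norm (f b - f t) \<le> M * norm (b - t)"
    by (rule field_differentiable_bound[of "{a..b}" f f']) (use f M t in auto)
  thus ?thesis using t \<open>f b = 0\<close> by simp
qed

text \<open>The condition \<open>u1 x = 0\<close> removes the singularity of the integrand and gains one power of the
  distance to \<open>x\<close> in every cell error. The cell \<open>k = 0\<close>, where \<open>(x - t) powr -\<alpha>\<close> is unbounded, is left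
  out of the sum and its integral is absorbed into the error.\<close>
lemma trapezoid_singular:
  fixes u u1 u2 :: "real \<Rightarrow> real" and \<alpha> x M :: real
  defines "\<phi> \<equiv> \<lambda>t. u1 t * (x - t) powr (-\<alpha>)"
  assumes \<alpha>: "0 < \<alpha>" "\<alpha> < 1" and x: "0 < x"
    and u: "\<And>t. t \<in> {0..x} \<Longrightarrow> (u has_real_derivative u1 t) (at t within {0..x})"
    and u1: "\<And>t. t \<in> {0..x} \<Longrightarrow> (u1 has_real_derivative u2 t) (at t within {0..x})"
    and M: "\<And>t. t \<in> {0..x} \<Longrightarrow> \<bar>u2 t\<bar> \<le> M" and end0: "u1 x = 0"
  shows "continuous_on {0..x} \<phi>"
    and "\<exists>C. \<forall>n\<ge>1. \<bar>(\<Sum>k=1..<n. (u (x - real k * (x/n)) - u (x - (real k + 1) * (x/n)))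
             * ((real k * (x/n)) powr (-\<alpha>) + ((real k + 1) * (x/n)) powr (-\<alpha>)) / 2)
           - integral {0..x} \<phi>\<bar> \<le> C * (x / real n) powr (2 - \<alpha>)"
proof -
  have M0: "0 \<le> M" using M[of 0] x by auto
  have u1_le: "\<bar>u1 t\<bar> \<le> M * (x - t)" if "t \<in> {0..x}" for t
    by (rule abs_le_of_zero_at_right_end[OF u1 M end0 that])
  have \<phi>_le: "\<bar>\<phi> t\<bar> \<le> M * (x - t) powr (1 - \<alpha>)" if "t \<in> {0..x}" for t
  proof (cases "t = x")
    case False
    hence "(x - t) powr (1 - \<alpha>) = (x - t) * (x - t) powr (-\<alpha>)"
      using that powr_add[of "x - t" 1 "-\<alpha>"] by simp
    thus ?thesis using mult_right_mono[OF u1_le[OF that], of "(x - t) powr (-\<alpha>)"]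
      by (simp add: \<phi>_def abs_mult mult.assoc)
  qed (simp add: \<phi>_def)
  show cont: "continuous_on {0..x} \<phi>"
    unfolding continuous_on_eq_continuous_within
  proof
    fix t assume t: "t \<in> {0..x}"
    show "continuous (at t within {0..x}) \<phi>"
    proof (cases "t = x")
      case True
      have "((\<lambda>s. M * (x - s) powr (1 - \<alpha>)) \<longlongrightarrow> M * (x - x) powr (1 - \<alpha>)) (at x within {0..x})"
        using \<alpha> by (intro tendsto_intros) (auto simp: eventually_at_filter)
      hence lim: "((\<lambda>s. M * (x - s) powr (1 - \<alpha>)) \<longlongrightarrow> 0) (at x within {0..x})" by simp
      have "(\<phi> \<longlongrightarrow> 0) (at x within {0..x})"
        by (rule Lim_null_comparison[OF _ lim]) (use \<phi>_le in \<open>auto simp: eventually_at_filter\<close>)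
      thus ?thesis using True by (simp add: continuous_within \<phi>_def)
    next
      case False
      thus ?thesis unfolding \<phi>_def using t DERIV_isCont
        by (intro continuous_intros DERIV_continuous[OF u1[OF t]]) auto
    qed
  qed
  define P where "P = (\<lambda>t. integral {0..t} \<phi>)"
  have P: "(P has_real_derivative \<phi> t) (at t within {0..x})" if "t \<in> {0..x}" for t
    unfolding P_def by (rule integral_has_real_derivative[OF cont that])
  define Z where "Z = (\<Sum>j. real (Suc j) powr (-\<alpha> - 1))"
  have "\<bar>(\<Sum>k=1..<n. (u (x - real k * h) - u (x - (real k + 1) * h))
             * ((real k * h) powr (-\<alpha>) + ((real k + 1) * h) powr (-\<alpha>)) / 2)
           - integral {0..x} \<phi>\<bar> \<le> (5 * M * Z + M) * h powr (2 - \<alpha>)"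
    if n: "1 \<le> n" and h_def: "h = x / real n" for n h
  proof -
    have h: "0 < h" "real n * h = x" "h \<le> x" using n x by (auto simp: h_def field_simps)
    define q where "q = (\<lambda>k. (u (x - real k * h) - u (x - (real k + 1) * h))
             * ((real k * h) powr (-\<alpha>) + ((real k + 1) * h) powr (-\<alpha>)) / 2)"
    have cell: "\<bar>P (x - real k * h) - P (x - (real k + 1) * h) - q k\<bar>
        \<le> 5 * M * h powr (2 - \<alpha>) * real k powr (-\<alpha> - 1)" if k: "k \<in> {1..<n}" for k
    proof -
      define s where "s = real k * h"
      define a where "a = x - (real k + 1) * h"
      have s: "0 < s" using k h by (simp add: s_def)
      have hs: "h \<le> s" using k h by (simp add: s_def)
      have "(real k + 1) * h \<le> real n * h" using k h by (intro mult_right_mono) auto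
      hence sub: "{a..x - s} \<subseteq> {0..x}" and a0: "0 \<le> a" using h s by (auto simp: a_def)
      have ab: "a = x - s - h" "x - s - a = h" by (auto simp: a_def s_def algebra_simps)
      have "\<bar>P (x - s) - P a - (u (x - s) - u a) * ((x - a) powr (-\<alpha>) + (x - (x - s)) powr (-\<alpha>)) / 2\<bar>
          \<le> ((2 * M * s) * (\<alpha> * (\<alpha>+1) * s powr (-\<alpha>-2)) + M * (\<alpha> * s powr (-\<alpha>-1))) * (x - s - a) ^ 3"
      proof (rule trapezoid_stieltjes[where ?u1.0 = u1 and ?u2.0 = u2
            and ?\<omega>1.0 = "\<lambda>t. \<alpha> * (x - t) powr (-\<alpha>-1)" and ?\<omega>2.0 = "\<lambda>t. \<alpha> * (\<alpha>+1) * (x - t) powr (-\<alpha>-2)"])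
        show "a \<le> x - s" using ab h by simp
        fix t assume t: "t \<in> {a..x - s}"
        hence tx: "t \<in> {0..x}" using sub by auto
        have pos: "s \<le> x - t" "0 < x - t" "x - t \<le> 2 * s" using t s ab hs by auto
        show "(P has_real_derivative u1 t * (x - t) powr (-\<alpha>)) (at t within {a..x - s})"
          using DERIV_subset[OF P[OF tx] sub] by (simp add: \<phi>_def)
        show "(u has_real_derivative u1 t) (at t within {a..x - s})" by (rule DERIV_subset[OF u[OF tx] sub])
        show "(u1 has_real_derivative u2 t) (at t within {a..x - s})" by (rule DERIV_subset[OF u1[OF tx] sub])
        have D: "((\<lambda>t. (x - t) powr r) has_real_derivative (r * (x - t) powr (r - 1)) * (-1)) (at t within A)" for r A
          by (rule has_field_derivative_at_within, rule DERIV_chain2[where f = "\<lambda>z. z powr r" and g = "\<lambda>t. x - t", OF has_real_derivative_powr[OF pos(2)]])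
             (auto intro!: derivative_eq_intros)
        show "((\<lambda>t. (x - t) powr (-\<alpha>)) has_real_derivative \<alpha> * (x - t) powr (-\<alpha>-1)) (at t within {a..x - s})"
          using D[where r = "-\<alpha>"] by simp
        have "\<alpha> * ((-\<alpha>-1) * (x - t) powr (-\<alpha>-1-1) * (-1)) = \<alpha> * (\<alpha>+1) * (x - t) powr (-\<alpha>-2)"
          by (simp add: algebra_simps)
        thus "((\<lambda>t. \<alpha> * (x - t) powr (-\<alpha>-1)) has_real_derivative \<alpha> * (\<alpha>+1) * (x - t) powr (-\<alpha>-2)) (at t within {a..x - s})"
          using DERIV_cmult[OF D[where r = "-\<alpha>-1"], where c = \<alpha>] by simp
        have "M * (x - t) \<le> M * (2 * s)" using pos M0 by (intro mult_left_mono) auto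
        thus "\<bar>u1 t\<bar> \<le> 2 * M * s" using u1_le[OF tx] by simp
        show "\<bar>u2 t\<bar> \<le> M" by (rule M[OF tx])
        have "(x - t) powr (-\<alpha>-1) \<le> s powr (-\<alpha>-1)" using pos s \<alpha> by (intro powr_mono2') auto
        thus "\<bar>\<alpha> * (x - t) powr (-\<alpha>-1)\<bar> \<le> \<alpha> * s powr (-\<alpha>-1)" using \<alpha> by (simp add: abs_mult)
        have "(x - t) powr (-\<alpha>-2) \<le> s powr (-\<alpha>-2)" using pos s \<alpha> by (intro powr_mono2') auto
        thus "\<bar>\<alpha> * (\<alpha>+1) * (x - t) powr (-\<alpha>-2)\<bar> \<le> \<alpha> * (\<alpha>+1) * s powr (-\<alpha>-2)"
          using \<alpha> by (simp add: abs_mult)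
      qed
      also have "(u (x - s) - u a) * ((x - a) powr (-\<alpha>) + (x - (x - s)) powr (-\<alpha>)) / 2 = q k"
        by (simp add: q_def a_def s_def add.commute)
      also have "((2 * M * s) * (\<alpha> * (\<alpha>+1) * s powr (-\<alpha>-2)) + M * (\<alpha> * s powr (-\<alpha>-1))) * (x - s - a) ^ 3
          = (M * (\<alpha> * (2 * \<alpha> + 3))) * (s powr (-\<alpha>-1) * h ^ 3)"
      proof -
        have "s powr (-\<alpha>-1) = s * s powr (-\<alpha>-2)" 
        proof -
          have e: "-\<alpha>-1 = 1 + (-\<alpha>-2)" by simp
          show ?thesis unfolding e powr_add using s by simp
        qed
        thus ?thesis unfolding ab(2) by (simp add: algebra_simps)
      qed
      also have "s powr (-\<alpha>-1) * h ^ 3 = h powr (2 - \<alpha>) * real k powr (-\<alpha>-1)"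
      proof -
        have "h powr (2 - \<alpha>) = h powr (-\<alpha>-1) * h powr 3" by (simp add: powr_add[symmetric])
        thus ?thesis using h k by (simp add: s_def powr_mult powr_numeral)
      qed
      also have "(M * (\<alpha> * (2 * \<alpha> + 3))) * (h powr (2 - \<alpha>) * real k powr (-\<alpha>-1))
          \<le> (M * 5) * (h powr (2 - \<alpha>) * real k powr (-\<alpha>-1))"
        using M0 \<alpha> mult_mono[of \<alpha> 1 "2 * \<alpha> + 3" 5] by (intro mult_right_mono mult_left_mono) auto
      finally show ?thesis by (simp add: s_def a_def mult_ac)
    qed
    have telescope: "(\<Sum>k=1..<n. P (x - real k * h) - P (x - (real k + 1) * h)) = P (x - h)"
    proof -
      have "(\<Sum>k=1..<n. P (x - real k * h) - P (x - (real k + 1) * h)) = P (x - 1 * h) - P (x - real n * h)"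
        using n by (induction n rule: dec_induct) (simp_all add: algebra_simps)
      thus ?thesis using h by (simp add: P_def)
    qed
    have "\<bar>P (x - h) - (\<Sum>k=1..<n. q k)\<bar> = \<bar>\<Sum>k=1..<n. P (x - real k * h) - P (x - (real k + 1) * h) - q k\<bar>"
      by (simp add: sum_subtractf telescope[symmetric])
    also have "\<dots> \<le> (\<Sum>k=1..<n. \<bar>P (x - real k * h) - P (x - (real k + 1) * h) - q k\<bar>)" by (rule sum_abs)
    also have "\<dots> \<le> (\<Sum>k=1..<n. 5 * M * h powr (2 - \<alpha>) * real k powr (-\<alpha> - 1))" by (rule sum_mono[OF cell])
    also have "\<dots> = 5 * M * h powr (2 - \<alpha>) * (\<Sum>k=1..<n. real k powr (-\<alpha> - 1))" by (simp add: sum_distrib_left)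
    also have "(\<Sum>k=1..<n. real k powr (-\<alpha> - 1)) \<le> Z"
    proof -
      obtain m where m: "n = Suc m" using n by (cases n) auto
      have "(\<Sum>k=1..<n. real k powr (-\<alpha> - 1)) = (\<Sum>j<m. real (Suc j) powr (-\<alpha> - 1))"
        unfolding m One_nat_def sum.atLeast_Suc_lessThan_Suc_shift by (simp add: atLeast0LessThan)
      also have "\<dots> \<le> Z" unfolding Z_def by (rule sum_le_suminf[OF summable_Suc_powr[OF \<alpha>(1)]]) auto
      finally show ?thesis .
    qed
    finally have inner: "\<bar>P (x - h) - (\<Sum>k=1..<n. q k)\<bar> \<le> 5 * M * h powr (2 - \<alpha>) * Z"
      using M0 by (simp add: mult_left_mono)
    have sub: "{x - h..x} \<subseteq> {0..x}" using h by auto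
    have "norm (P x - P (x - h)) \<le> (M * h powr (1 - \<alpha>)) * norm (x - (x - h))"
    proof (rule field_differentiable_bound[of "{x - h..x}" P \<phi>])
      fix t assume t: "t \<in> {x - h..x}"
      show "(P has_real_derivative \<phi> t) (at t within {x - h..x})"
        using t sub by (intro DERIV_subset[OF P sub]) auto
      have "M * (x - t) powr (1 - \<alpha>) \<le> M * h powr (1 - \<alpha>)"
        using t M0 \<alpha> by (intro mult_left_mono powr_mono2) auto
      thus "norm (\<phi> t) \<le> M * h powr (1 - \<alpha>)" using \<phi>_le[of t] t sub by force
    qed (use h in auto)
    also have "\<dots> = M * h powr (2 - \<alpha>)" using h powr_add[of h "1 - \<alpha>" 1] by simp
    finally have "\<bar>P x - P (x - h)\<bar> \<le> M * h powr (2 - \<alpha>)" by simp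
    with inner have "\<bar>(\<Sum>k=1..<n. q k) - P x\<bar> \<le> 5 * M * h powr (2 - \<alpha>) * Z + M * h powr (2 - \<alpha>)" by linarith
    thus ?thesis by (simp add: q_def P_def algebra_simps)
  qed
  thus "\<exists>C. \<forall>n\<ge>1. \<bar>(\<Sum>k=1..<n. (u (x - real k * (x/n)) - u (x - (real k + 1) * (x/n)))
             * ((real k * (x/n)) powr (-\<alpha>) + ((real k + 1) * (x/n)) powr (-\<alpha>)) / 2)
           - integral {0..x} \<phi>\<bar> \<le> C * (x / real n) powr (2 - \<alpha>)" by blast
qed

section \<open>The weights as a sum over cells\<close>

text \<open>Both sides are \<open>\<Sum>k=1..m+1. w k * (z (k-1) - z (k+1))\<close>: on the left it is ordered by the
  values \<open>z k\<close>; on the right each central difference is split into its two cells, and the two end terms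
  repair the shift of index.\<close>
lemma central_difference_sum:
  fixes z w :: "nat \<Rightarrow> real"
  assumes "1 \<le> m"
  shows "w 1 * z 0 + w 2 * z 1 + (\<Sum>k=2..m. (w (k+1) - w (k-1)) * z k) - w m * z (m+1) - w (m+1) * z (m+2)
    = (\<Sum>k=1..m+1. (w k + w (k+1)) * (z k - z (k+1))) + w 1 * (z 0 - z 1) - w (m+2) * (z (m+1) - z (m+2))"
  using assms
proof (induction m rule: dec_induct)
  case base
  show ?case by (simp add: algebra_simps numeral_eq_Suc)
next
  case (step m)
  have "(\<Sum>k=2..Suc m. (w (k+1) - w (k-1)) * z k)
      = (\<Sum>k=2..m. (w (k+1) - w (k-1)) * z k) + (w (m+2) - w m) * z (m+1)"
    using step by simp
  with step.IH show ?case by (simp add: algebra_simps numeral_eq_Suc)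
qed

lemma sigma_sum_eq:
  fixes z :: "nat \<Rightarrow> real"
  assumes "4 \<le> n"
  shows "(\<Sum>k=0..n. \<sigma> \<alpha> n k * z k)
    = (\<Sum>k=1..<n. (real k powr (-\<alpha>) + real (k+1) powr (-\<alpha>)) * (z k - z (k+1)))
      + (1 - 2 * zeta_real \<alpha>) * (z 0 - z 1) - endpoint_weight \<alpha> n * (z (n-1) - z n)"
proof -
  define m where "m = n - 2"
  have m: "n = Suc (Suc m)" "2 \<le> m" using assms by (auto simp: m_def)
  define w where "w = (\<lambda>k. real k powr (-\<alpha>))"
  define R where "R = S n \<alpha> - real n powr (1-\<alpha>) / (1-\<alpha>)"
  have "{0..n} = insert 0 (insert 1 (insert (m+1) (insert (m+2) {2..m})))" using m by auto
  hence "(\<Sum>k=0..n. \<sigma> \<alpha> n k * z k) = \<sigma> \<alpha> n 0 * z 0 + \<sigma> \<alpha> n 1 * z 1 + \<sigma> \<alpha> n (m+1) * z (m+1) + \<sigma> \<alpha> n (m+2) * z (m+2)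
      + (\<Sum>k=2..m. \<sigma> \<alpha> n k * z k)"
    using m by simp
  also have "(\<Sum>k=2..m. \<sigma> \<alpha> n k * z k) = (\<Sum>k=2..m. (w (k+1) - w (k-1)) * z k)"
    by (rule sum.cong) (auto simp: \<sigma>_def w_def m powr_minus_divide add_ac of_nat_diff)
  also have "\<sigma> \<alpha> n 0 = w 1 - 2 * zeta_real \<alpha>" by (simp add: \<sigma>_def w_def)
  also have "\<sigma> \<alpha> n 1 = w 2 + 2 * zeta_real \<alpha>" by (simp add: \<sigma>_def w_def powr_minus_divide)
  also have "\<sigma> \<alpha> n (m+1) = - w m - 2 * R"
    using m by (simp add: R_def \<sigma>_def w_def powr_minus_divide algebra_simps)
  also have "\<sigma> \<alpha> n (m+2) = - w (m+1) + 2 * R"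
    using m by (simp add: R_def \<sigma>_def w_def powr_minus_divide algebra_simps)
  finally have 1: "(\<Sum>k=0..n. \<sigma> \<alpha> n k * z k)
      = (w 1 * z 0 + w 2 * z 1 + (\<Sum>k=2..m. (w (k+1) - w (k-1)) * z k) - w m * z (m+1) - w (m+1) * z (m+2))
        - 2 * zeta_real \<alpha> * (z 0 - z 1) - 2 * R * (z (m+1) - z (m+2))"
    by (simp add: algebra_simps)
  have set_eq: "{1..<n} = {1..m+1}" using m by auto
  have sum_eq: "(\<Sum>k=1..<n. (real k powr (-\<alpha>) + real (k+1) powr (-\<alpha>)) * (z k - z (k+1)))
      = (\<Sum>k=1..m+1. (w k + w (k+1)) * (z k - z (k+1)))"
    unfolding set_eq w_def ..
  have ends: "endpoint_weight \<alpha> n = w (m+2) + 2 * R" "n - 1 = m + 1" "n = m + 2" "w 1 = 1"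
    using m by (simp_all add: endpoint_weight_def w_def R_def)
  have "1 \<le> m" using m by simp
  from central_difference_sum[OF this, of w z] show ?thesis
    unfolding 1 sum_eq ends(1,2) unfolding ends(3,4) by (simp add: algebra_simps)
qed

text \<open>This is the previous sum when all increments \<open>z k - z (k+1)\<close> are \<open>1\<close>; multiplied by
  \<open>h powr (1-\<alpha>) / 2\<close>, it is the integral of \<open>(x - t) powr -\<alpha>\<close> over \<open>{0..x}\<close>, so the scheme is exact for linear functions.\<close>
lemma sigma_sum_linear:
  assumes "1 \<le> n"
  shows "(\<Sum>k=1..<n. real k powr (-\<alpha>) + real (k+1) powr (-\<alpha>)) + (1 - 2 * zeta_real \<alpha>) - endpoint_weight \<alpha> n
    = 2 * real n powr (1-\<alpha>) / (1-\<alpha>)"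
proof -
  have "(\<Sum>k=1..<n. real k powr (-\<alpha>) + real (k+1) powr (-\<alpha>))
      = 2 * (\<Sum>k=1..<n. real k powr (-\<alpha>)) - 1 + real n powr (-\<alpha>)"
    using assms by (induction n rule: dec_induct) simp_all
  thus ?thesis by (simp add: endpoint_weight_def S_def)
qed

section \<open>The order of the scheme\<close>

theorem mainTheorem1:
  fixes \<alpha> x :: real and y :: "real \<Rightarrow> real"
  assumes "0 < \<alpha>" and "\<alpha> < 1" and "0 < x"
    and "C_infinity_on {0..x} y"
  shows "(\<lambda>n::nat. let h = x / real n in
            1 / (2 * Gamma (1 - \<alpha>) * h powr \<alpha>) *
              (\<Sum>k=0..n. \<sigma> \<alpha> n k * y (real (n - k) * h)) - caputo \<alpha> y x)
         \<in> O(\<lambda>n. (x / real n) powr (2 - \<alpha>))"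
proof -
  note \<alpha> = assms(1,2) and x = assms(3)
  define y1 where "y1 = deriv_on {0..x} y"
  define y2 where "y2 = deriv_on {0..x} y1"
  have smooth: "y differentiable_on {0..x}" "y1 differentiable_on {0..x}" "y2 differentiable_on {0..x}"
    using assms(4)[unfolded C_infinity_on_def, rule_format, of 0]
      assms(4)[unfolded C_infinity_on_def, rule_format, of 1]
      assms(4)[unfolded C_infinity_on_def, rule_format, of 2]
    by (simp_all add: y1_def y2_def numeral_2_eq_2)
  have D: "(f has_real_derivative deriv_on {0..x} f t) (at t within {0..x})"
    if "f differentiable_on {0..x}" "t \<in> {0..x}" for f t
    using that by (simp add: deriv_on_def differentiable_on_def vector_derivative_works
        has_real_derivative_iff_has_vector_derivative)
  have Dy: "(y has_real_derivative y1 t) (at t within {0..x})"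
    and Dy1: "(y1 has_real_derivative y2 t) (at t within {0..x})" if "t \<in> {0..x}" for t
    unfolding y1_def y2_def using D[OF _ that] smooth by (auto simp: y1_def)
  have "compact (y2 ` {0..x})"
    by (intro compact_continuous_image differentiable_imp_continuous_on smooth compact_Icc)
  then obtain M where "\<forall>t\<in>{0..x}. \<bar>y2 t\<bar> \<le> M"
    by (auto dest!: compact_imp_bounded simp: bounded_iff)
  hence M: "\<bar>y2 t\<bar> \<le> M" if "t \<in> {0..x}" for t using that by blast
  define c where "c = y1 x"
  \<comment> \<open>Remove the linear part, for which the scheme is exact, so that \<open>u1 x = 0\<close>.\<close>
  define u where "u = (\<lambda>t. y t - c * t)"
  define u1 where "u1 = (\<lambda>t. y1 t - c)"
  have Du: "(u has_real_derivative u1 t) (at t within {0..x})"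
    and Du1: "(u1 has_real_derivative y2 t) (at t within {0..x})" if "t \<in> {0..x}" for t
    unfolding u_def u1_def
    by (auto intro!: derivative_eq_intros Dy[OF that] Dy1[OF that])
  have u1x: "u1 x = 0" by (simp add: u1_def c_def)
  note sing = trapezoid_singular[OF \<alpha> x Du Du1 M u1x]
  define I where "I = integral {0..x} (\<lambda>t. u1 t * (x - t) powr (-\<alpha>))"
  have M0: "0 \<le> M" using M[of 0] x by auto
  have u1_le: "\<bar>u1 t\<bar> \<le> M * (x - t)" if "t \<in> {0..x}" for t
    by (rule abs_le_of_zero_at_right_end[OF Du1 M u1x that])
  have u_step: "\<bar>u b - u a\<bar> \<le> M * (x - a) * (b - a)" if ab: "0 \<le> a" "a \<le> b" "b \<le> x" for a b
  proof -
    have sub: "{a..b} \<subseteq> {0..x}" using ab by auto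
    have "norm (u b - u a) \<le> M * (x - a) * norm (b - a)"
    proof (rule field_differentiable_bound[of "{a..b}" u u1])
      fix t assume t: "t \<in> {a..b}"
      show "(u has_real_derivative u1 t) (at t within {a..b})"
        using t sub by (intro DERIV_subset[OF Du sub]) auto
      have "M * (x - t) \<le> M * (x - a)" using t M0 by (intro mult_left_mono) auto
      thus "norm (u1 t) \<le> M * (x - a)" using u1_le[of t] t sub by force
    qed (use ab in auto)
    thus ?thesis using ab by simp
  qed
  have caputo: "caputo \<alpha> y x = 1 / Gamma (1 - \<alpha>) * (I + c * x powr (1 - \<alpha>) / (1 - \<alpha>))"
  proof -
    have "((\<lambda>t. u1 t * (x - t) powr (-\<alpha>)) has_integral I) {0..x}"
      unfolding I_def by (intro integrable_integral integrable_continuous_real sing(1)) auto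
    moreover have "((\<lambda>t. (x - t) powr (-\<alpha>)) has_integral
        (- ((x - x) powr (1 - \<alpha>) / (1 - \<alpha>)) - - ((x - 0) powr (1 - \<alpha>) / (1 - \<alpha>)))) {0..x}"
    proof (rule fundamental_theorem_of_calculus_interior)
      show "continuous_on {0..x} (\<lambda>t. - ((x - t) powr (1 - \<alpha>) / (1 - \<alpha>)))"
        using \<alpha> by (intro continuous_intros continuous_on_powr') auto
      fix t assume t: "t \<in> {0<..<x}"
      have "((\<lambda>t. (x - t) powr (1 - \<alpha>)) has_real_derivative ((1 - \<alpha>) * (x - t) powr (1 - \<alpha> - 1)) * (-1)) (at t)"
        by (rule DERIV_chain2[where f = "\<lambda>z. z powr (1 - \<alpha>)" and g = "\<lambda>t. x - t", OF has_real_derivative_powr])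
           (use t in \<open>auto intro!: derivative_eq_intros\<close>)
      from DERIV_minus[OF DERIV_cdivide[OF this, where c = "1 - \<alpha>"]]
      show "((\<lambda>t. - ((x - t) powr (1 - \<alpha>) / (1 - \<alpha>))) has_vector_derivative (x - t) powr (-\<alpha>)) (at t)"
        unfolding has_real_derivative_iff_has_vector_derivative[symmetric] using \<alpha> by simp
    qed (use x in auto)
    ultimately have "((\<lambda>t. u1 t * (x - t) powr (-\<alpha>) + c * (x - t) powr (-\<alpha>)) has_integral
        (I + c * (x powr (1 - \<alpha>) / (1 - \<alpha>)))) {0..x}"
      by (intro has_integral_add has_integral_mult_right) simp_all
    moreover have "u1 t * (x - t) powr (-\<alpha>) + c * (x - t) powr (-\<alpha>) = y1 t / (x - t) powr \<alpha>" for t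
      by (simp add: u1_def powr_minus_divide diff_divide_distrib)
    ultimately show ?thesis by (simp add: caputo_def y1_def[symmetric] integral_unique)
  qed
  obtain C where C: "\<And>n. 1 \<le> n \<Longrightarrow>
      \<bar>(\<Sum>k=1..<n. (u (x - real k * (x/n)) - u (x - (real k + 1) * (x/n)))
             * ((real k * (x/n)) powr (-\<alpha>) + ((real k + 1) * (x/n)) powr (-\<alpha>)) / 2) - I\<bar>
      \<le> C * (x / real n) powr (2 - \<alpha>)"
    using sing(2) unfolding I_def by blast
  define K where "K = \<bar>1 / Gamma (1 - \<alpha>)\<bar> * (C + \<bar>1 - 2 * zeta_real \<alpha>\<bar> * M / 2 + 8 * M)"
  have "norm (let h = x / real n in 1 / (2 * Gamma (1 - \<alpha>) * h powr \<alpha>) *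
              (\<Sum>k=0..n. \<sigma> \<alpha> n k * y (real (n - k) * h)) - caputo \<alpha> y x)
      \<le> K * norm ((x / real n) powr (2 - \<alpha>))" if n: "4 \<le> n" for n
  proof -
    define h where "h = x / real n"
    have h: "0 < h" "real n * h = x" "h \<le> x" using n x by (auto simp: h_def field_simps)
    define d where "d = (\<lambda>k. u (x - real k * h) - u (x - (real k + 1) * h))"
    define w where "w = (\<lambda>k. real k powr (-\<alpha>))"
    define B where "B = endpoint_weight \<alpha> n"
    define T where "T = (\<Sum>k=1..<n. d k * ((real k * h) powr (-\<alpha>) + ((real k + 1) * h) powr (-\<alpha>)) / 2)"
    have node: "real (n - k) * h = x - real k * h" if "k \<le> n" for k
      using that h(2) by (simp add: of_nat_diff left_diff_distrib)
    have step: "y (real (n - k) * h) - y (real (n - (k+1)) * h) = d k + c * h" if "k < n" for k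
      using that by (subst (1 2) node) (auto simp: d_def u_def algebra_simps)
    have step0: "y (real n * h) - y (real (n - 1) * h) = d 0 + c * h"
      using step[of 0] n by simp
    have stepn: "y (real (n - (n - 1)) * h) - y (real (n - n) * h) = d (n - 1) + c * h"
      using step[of "n - 1"] n by simp
    have "(\<Sum>k=0..n. \<sigma> \<alpha> n k * y (real (n - k) * h))
        = (\<Sum>k=1..<n. (w k + w (k+1)) * (d k + c * h)) + (1 - 2 * zeta_real \<alpha>) * (d 0 + c * h) - B * (d (n - 1) + c * h)"
    proof -
      have cells: "(\<Sum>k=1..<n. (w k + w (k+1)) * (y (real (n - k) * h) - y (real (n - (k+1)) * h)))
          = (\<Sum>k=1..<n. (w k + w (k+1)) * (d k + c * h))"
        by (rule sum.cong[OF refl], subst step) auto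
      show ?thesis
        using sigma_sum_eq[OF n, of \<alpha> "\<lambda>k. y (real (n - k) * h)"]
        unfolding cells[unfolded w_def] stepn diff_zero step0 w_def B_def .
    qed
    also have "\<dots> = (\<Sum>k=1..<n. (w k + w (k+1)) * d k) + (1 - 2 * zeta_real \<alpha>) * d 0 - B * d (n - 1)
        + c * h * ((\<Sum>k=1..<n. w k + w (k+1)) + (1 - 2 * zeta_real \<alpha>) - B)"
      by (simp add: distrib_left sum.distrib sum_distrib_left sum_distrib_right algebra_simps)
    also have "(\<Sum>k=1..<n. w k + w (k+1)) + (1 - 2 * zeta_real \<alpha>) - B = 2 * real n powr (1-\<alpha>) / (1-\<alpha>)"
      using sigma_sum_linear[of n \<alpha>] n by (simp add: w_def B_def)
    finally have sum_eq: "(\<Sum>k=0..n. \<sigma> \<alpha> n k * y (real (n - k) * h))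
        = (\<Sum>k=1..<n. (w k + w (k+1)) * d k) + (1 - 2 * zeta_real \<alpha>) * d 0 - B * d (n - 1)
          + c * h * (2 * real n powr (1-\<alpha>) / (1-\<alpha>))" .
    have T_eq: "h powr (-\<alpha>) / 2 * (\<Sum>k=1..<n. (w k + w (k+1)) * d k) = T"
    proof -
      have "(real k * h) powr (-\<alpha>) = w k * h powr (-\<alpha>)"
        "((real k + 1) * h) powr (-\<alpha>) = w (k+1) * h powr (-\<alpha>)" for k
        using h by (simp_all add: w_def powr_mult add.commute)
      thus ?thesis unfolding T_def sum_distrib_left by (simp only:) (simp add: algebra_simps add_divide_distrib)
    qed
    have lin_eq: "h powr (-\<alpha>) / 2 * (c * h * (2 * real n powr (1-\<alpha>) / (1-\<alpha>))) = c * x powr (1-\<alpha>) / (1-\<alpha>)"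
    proof -
      have "x powr (1-\<alpha>) = real n powr (1-\<alpha>) * h powr (1-\<alpha>)" using h powr_mult[of "real n" h "1-\<alpha>"] by simp
      also have "h powr (1-\<alpha>) = h powr (-\<alpha>) * h" using h powr_add[of h "-\<alpha>" 1] by simp
      finally show ?thesis by simp
    qed
    \<comment> \<open>Quadrature error plus the corrections in the cells at \<open>x\<close> and at \<open>0\<close>; the linear part has
      cancelled.\<close>
    define R where "R = (T - I) + (1 - 2 * zeta_real \<alpha>) * d 0 * (h powr (-\<alpha>) / 2) - B * d (n - 1) * (h powr (-\<alpha>) / 2)"
    have "1 / (2 * Gamma (1 - \<alpha>) * h powr \<alpha>) * (\<Sum>k=0..n. \<sigma> \<alpha> n k * y (real (n - k) * h))
        = 1 / Gamma (1 - \<alpha>) * (h powr (-\<alpha>) / 2 * (\<Sum>k=0..n. \<sigma> \<alpha> n k * y (real (n - k) * h)))"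
      by (simp add: powr_minus_divide)
    also have "h powr (-\<alpha>) / 2 * (\<Sum>k=0..n. \<sigma> \<alpha> n k * y (real (n - k) * h)) = R + I + c * x powr (1-\<alpha>) / (1-\<alpha>)"
      unfolding sum_eq distrib_left right_diff_distrib T_eq lin_eq R_def by (simp add: algebra_simps)
    finally have err: "1 / (2 * Gamma (1 - \<alpha>) * h powr \<alpha>) * (\<Sum>k=0..n. \<sigma> \<alpha> n k * y (real (n - k) * h)) - caputo \<alpha> y x
        = 1 / Gamma (1 - \<alpha>) * R"
      unfolding caputo by (simp add: algebra_simps)
    have hp: "h powr (2 - \<alpha>) = h * h * h powr (-\<alpha>)"
      using h powr_add[of h 2 "-\<alpha>"] by (simp add: powr_numeral power2_eq_square)
    have "\<bar>T - I\<bar> \<le> C * h powr (2 - \<alpha>)"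
      using C[of n] n by (simp add: T_def d_def h_def)
    moreover have "\<bar>(1 - 2 * zeta_real \<alpha>) * d 0 * (h powr (-\<alpha>) / 2)\<bar>
        \<le> \<bar>1 - 2 * zeta_real \<alpha>\<bar> * M / 2 * h powr (2 - \<alpha>)"
    proof -
      have "\<bar>d 0\<bar> \<le> M * h * h" using u_step[of "x - h" x] h by (simp add: d_def)
      hence "\<bar>1 - 2 * zeta_real \<alpha>\<bar> * \<bar>d 0\<bar> * (h powr (-\<alpha>) / 2)
          \<le> \<bar>1 - 2 * zeta_real \<alpha>\<bar> * (M * h * h) * (h powr (-\<alpha>) / 2)"
        by (intro mult_right_mono mult_left_mono) auto
      thus ?thesis by (simp add: abs_mult hp mult_ac)
    qed
    moreover have "\<bar>B * d (n - 1) * (h powr (-\<alpha>) / 2)\<bar> \<le> 8 * M * h powr (2 - \<alpha>)"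
    proof -
      have "(real (n - 1)) * h = x - h" "(real (n - 1) + 1) * h = x"
        using n h by (simp_all add: of_nat_diff algebra_simps)
      hence "d (n - 1) = u h - u 0" by (simp add: d_def)
      hence d: "\<bar>d (n - 1)\<bar> \<le> M * x * h" using u_step[of 0 h] h by simp
      have "\<bar>B\<bar> \<le> 4 * \<alpha> * (\<alpha> + 1) / (real n - 1)"
        using endpoint_weight_le[OF \<alpha>, of n] n by (simp add: B_def)
      also have "\<dots> \<le> 8 / (real n - 1)"
        using mult_mono[of \<alpha> 1 "\<alpha> + 1" 2] \<alpha> n by (intro divide_right_mono) auto
      also have "\<dots> \<le> 16 / real n" using n by (simp add: divide_simps)
      also have "\<dots> = 16 * h / x" using x n by (simp add: h_def)
      finally have "\<bar>B\<bar> * \<bar>d (n - 1)\<bar> \<le> (16 * h / x) * (M * x * h)"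
        using d h x by (intro mult_mono) auto
      hence "\<bar>B\<bar> * \<bar>d (n - 1)\<bar> * (h powr (-\<alpha>) / 2) \<le> (16 * h / x) * (M * x * h) * (h powr (-\<alpha>) / 2)"
        by (intro mult_right_mono) auto
      thus ?thesis using x by (simp add: abs_mult hp mult_ac)
    qed
    ultimately have "\<bar>R\<bar> \<le> (C + \<bar>1 - 2 * zeta_real \<alpha>\<bar> * M / 2 + 8 * M) * h powr (2 - \<alpha>)"
      unfolding R_def distrib_right by linarith
    hence "\<bar>1 / Gamma (1 - \<alpha>)\<bar> * \<bar>R\<bar> \<le> K * h powr (2 - \<alpha>)"
      unfolding K_def mult.assoc by (intro mult_left_mono) auto
    thus ?thesis unfolding Let_def h_def[symmetric] err real_norm_def abs_mult by simp
  qed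
  thus ?thesis by (intro bigoI[of _ K] eventually_sequentiallyI[of 4])
qed

end
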